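(* Let $n\ge2$ and $0\le k<n$ be integers, and let $G(\psi)$ and $G(\nu)$ be two Grand Lebesgue Spaces. Put $$V_0(\psi,\nu)=\inf_{\Delta\in(0,\infty)}\ \sup_{g\in Z(n,k),\ g^{(n)}\ne0}\left[\frac{\|T_\Delta g\|G(\nu)}{\phi(G(\nu),\Delta)}:\frac{\|T_\Delta g^{(n)}\|G(\psi)}{\phi(G(\psi),\Delta)}\right].$$ Then $$V_0(\psi,\nu)\ge\frac{k^k\,(n-k)^{n-k}}{n!\,(n+1)^{n+1}} .$$
   Context: **The class $Z(n,k)$.** Here $Z(n,k)$ is the set of functions $g:[0,1]\to\mathbb{R}$ having a generalized derivative $g^{(n)}$ of order $n$ on $[0,1]$ with $g^{(i)}(0)=0$ for $i=0,\dots,k-1$ and $g^{(j)}(1)=0$ for $j=0,\dots,n-k-1$. Both $g$ and $g^{(n)}$ are extended by zero to $x>1$. **Dilation.** For $\Delta>0$, $T_\Delta[g](x)=g(x/\Delta)$; thus $T_\Delta g$ and $T_\Delta g^{(n)}$ are supported on $[0,\Delta]$. **Grand Lebesgue Spaces.** Let $1\le A<B\le\infty$ and let $\psi$ be a continuous positive function on the open interval $(A,B)$ with $\inf_{p\in(A,B)}\psi(p)>0$ and $\sup_{p\in(A,B)}\psi(p)=\infty$. The space $G(\psi)=G(\psi;A,B)$ consists of all measurable functions $f$ with finite norm $$\|f\|G(\psi)=\sup_{p\in(A,B)}\frac{|f|_p}{\psi(p)},\qquad |f|_p=\left(\int|f(x)|^p\,dx\right)^{1/p}.$$ $G(\nu)$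 is defined in the same way for a function $\nu$ on its own interval. The fundamental function of $G(\psi)$ is $$\phi(G(\psi),\delta)=\sup_{p\in(A,B)}\frac{\delta^{1/p}}{\psi(p)},\qquad\delta>0.$$ **Conventions.** $u:v$ denotes the quotient $u/v$ (equal to $0$ when $v=\infty$ and $u<\infty$), and $0^0=1$. *)

theory Defs
  imports "HOL-Analysis.Analysis"
begin

definition test_function :: "(real \<Rightarrow> real) \<Rightarrow> bool" where
  "test_function \<phi> \<longleftrightarrow>
     (\<forall>m x. ((deriv ^^ m) \<phi>) differentiable (at x)) \<and>
     (\<exists>a b. 0 < a \<and> a < b \<and> b < 1 \<and> (\<forall>x. x \<notin> {a..b} \<longrightarrow> \<phi> x = 0))"

(* h is a generalized (Sobolev) derivative of order m of g on [0,1]. It is determined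
   almost everywhere, hence a relation rather than a function of g. *)
definition has_gen_deriv :: "nat \<Rightarrow> (real \<Rightarrow> real) \<Rightarrow> (real \<Rightarrow> real) \<Rightarrow> bool" where
  "has_gen_deriv m g h \<longleftrightarrow>
     set_integrable lebesgue {0..1} g \<and> set_integrable lebesgue {0..1} h \<and>
     (\<forall>\<phi>. test_function \<phi> \<longrightarrow>
        (LINT x:{0..1}|lebesgue. g x * (deriv ^^ m) \<phi> x) =
        (-1) ^ m * (LINT x:{0..1}|lebesgue. h x * \<phi> x))"

(* The boundary value at x of the derivative of order m is that of its version continuous
   on [0,1]. This version is unique, and it exists whenever g has a generalized derivative
   of some order greater than m. *)
definition gen_deriv_value :: "nat \<Rightarrow> (real \<Rightarrow> real) \<Rightarrow> real \<Rightarrow> real \<Rightarrow> bool" where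
  "gen_deriv_value m g x c \<longleftrightarrow>
     (\<exists>d. continuous_on {0..1} d \<and> has_gen_deriv m g d \<and> d x = c)"

(* A function on [0,1] is a real function of which only the values on [0,1] matter. *)
definition Z :: "nat \<Rightarrow> nat \<Rightarrow> (real \<Rightarrow> real) set" where
  "Z n k = {g. continuous_on {0..1} g \<and> (\<exists>h. has_gen_deriv n g h) \<and>
               (\<forall>i<k. gen_deriv_value i g 0 0) \<and>
               (\<forall>j<n - k. gen_deriv_value j g 1 0)}"

definition zero_extension :: "(real \<Rightarrow> real) \<Rightarrow> real \<Rightarrow> real" where
  "zero_extension f x = (if x \<in> {0..1} then f x else 0)"

definition dilation :: "real \<Rightarrow> (real \<Rightarrow> real) \<Rightarrow> real \<Rightarrow> real" where
  "dilation \<Delta> f x = f (x / \<Delta>)"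

definition Lp_norm :: "real \<Rightarrow> (real \<Rightarrow> real) \<Rightarrow> ennreal" where
  "Lp_norm p f =
     (let I = (\<integral>\<^sup>+ x. ennreal (\<bar>f x\<bar> powr p) \<partial>lebesgue)
      in if I = \<infinity> then \<infinity> else ennreal (enn2real I powr (1 / p)))"

definition exponents :: "real \<Rightarrow> ereal \<Rightarrow> real set" where
  "exponents A B = {p. A < p \<and> ereal p < B}"

(* The admissible data (A, B, \<psi>) of a Grand Lebesgue Space. *)
definition gls_weight :: "real \<Rightarrow> ereal \<Rightarrow> (real \<Rightarrow> real) \<Rightarrow> bool" where
  "gls_weight A B \<psi> \<longleftrightarrow>
     1 \<le> A \<and> ereal A < B \<and>
     continuous_on (exponents A B) \<psi> \<and>
     (\<forall>p\<in>exponents A B. 0 < \<psi> p) \<and>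
     0 < (INF p\<in>exponents A B. ereal (\<psi> p)) \<and>
     (SUP p\<in>exponents A B. ereal (\<psi> p)) = \<infinity>"

(* The norm of G(\<psi>; A, B) for measurable f, infinite if f is not in the space. *)
definition gls_norm :: "real \<Rightarrow> ereal \<Rightarrow> (real \<Rightarrow> real) \<Rightarrow> (real \<Rightarrow> real) \<Rightarrow> ennreal" where
  "gls_norm A B \<psi> f = (SUP p\<in>exponents A B. Lp_norm p f / ennreal (\<psi> p))"

definition gls_fundamental :: "real \<Rightarrow> ereal \<Rightarrow> (real \<Rightarrow> real) \<Rightarrow> real \<Rightarrow> ennreal" where
  "gls_fundamental A B \<psi> \<delta> = (SUP p\<in>exponents A B. ennreal (\<delta> powr (1 / p) / \<psi> p))"

(* In ennreal, u / \<infinity> = 0. The other degenerate quotients do not arise: the fundamental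
   functions are positive and finite, elements of Z n k are bounded on [0,1] and so have
   finite norm, and the norm of h is positive unless h = 0 almost everywhere. *)
definition V0 ::
  "nat \<Rightarrow> nat \<Rightarrow> real \<Rightarrow> ereal \<Rightarrow> (real \<Rightarrow> real) \<Rightarrow> real \<Rightarrow> ereal \<Rightarrow> (real \<Rightarrow> real) \<Rightarrow> ennreal" where
  "V0 n k A B \<psi> C D \<nu> =
     (INF \<Delta>\<in>{0<..}.
        SUP (g, h) \<in> {(g, h). g \<in> Z n k \<and> has_gen_deriv n g h \<and>
                              \<not> (AE x in lebesgue. x \<in> {0..1} \<longrightarrow> h x = 0)}.
          (gls_norm C D \<nu> (dilation \<Delta> (zero_extension g)) / gls_fundamental C D \<nu> \<Delta>) /
          (gls_norm A B \<psi> (dilation \<Delta> (zero_extension h)) / gls_fundamental A B \<psi> \<Delta>))"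

end

theory Submission
  imports Defs
begin

text \<open>
  A single function \<open>g\<close> bounds the supremum in \<open>V0\<close> from below for every \<open>\<Delta>\<close> at once, namely
  \<open>g x = x ^ k * (x - 1) ^ (n - k) / fact n\<close>. It has zeros of orders \<open>k\<close> at \<open>0\<close> and \<open>n - k\<close>
  at \<open>1\<close>, hence lies in \<open>Z n k\<close>, and its derivative of order \<open>n\<close> is the constant \<open>1\<close>.

  Dilating by \<open>\<Delta>\<close> multiplies every \<open>L\<^sup>p\<close> norm by \<open>\<Delta> powr (1 / p)\<close>. On \<open>[0,1]\<close> all
  \<open>L\<^sup>p\<close> norms of the constant \<open>1\<close> equal \<open>1\<close>, so the Grand Lebesgue norm of its dilation is
  exactly the fundamental function at \<open>\<Delta>\<close> and the denominator of the quotient is \<open>1\<close>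
  (\<open>gls_norm_dilation_1\<close>). For the numerator, \<open>[0,1]\<close> has measure \<open>1\<close>, so Jensen's inequality
  bounds each \<open>L\<^sup>p\<close> norm of \<open>g\<close> from below by its \<open>L\<^sup>1\<close> norm \<open>c\<close>; thus the norm of the dilation
  of \<open>g\<close> is at least \<open>c\<close> times the fundamental function (\<open>gls_norm_dilation_ge\<close>), and the
  quotient is at least \<open>c\<close>, whatever \<open>\<Delta>\<close> and the weights are.

  The number \<open>c\<close> is a Beta integral, \<open>c = fact k * fact (n - k) / (fact (n + 1) * fact n)\<close>, and
  the binomial theorem shows that it is at least the constant of the theorem
  (\<open>power_mult_power_le_fact\<close>).
\<close>

section \<open>Polynomials and generalized derivatives\<close>

lemma test_function_deriv:
  assumes "test_function \<phi>"
  shows "test_function (deriv \<phi>)"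
proof -
  obtain a b where ab: "0 < a" "a < b" "b < 1" and zero: "\<And>x. x \<notin> {a..b} \<Longrightarrow> \<phi> x = 0"
    using assms unfolding test_function_def by blast
  have "deriv \<phi> x = 0" if "x \<notin> {a..b}" for x
  proof -
    have "eventually (\<lambda>y. y \<in> - {a..b}) (nhds x)"
      using that by (intro eventually_nhds_in_open) auto
    then have "eventually (\<lambda>y. \<phi> y = (\<lambda>_. 0) y) (nhds x)"
      by eventually_elim (use zero in auto)
    then show ?thesis
      by (subst deriv_cong_ev[OF _ refl]) auto
  qed
  moreover have "((deriv ^^ m) (deriv \<phi>)) differentiable (at x)" for m x
    using assms unfolding test_function_def by (metis comp_apply funpow_Suc_right)
  ultimately show ?thesis
    unfolding test_function_def using ab by blast
qed

lemma test_function_DERIV: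
  assumes "test_function \<phi>"
  shows "(\<phi> has_real_derivative deriv \<phi> x) (at x)"
proof -
  have "((deriv ^^ 0) \<phi>) differentiable (at x)"
    using assms unfolding test_function_def by blast
  then show ?thesis
    by (simp add: DERIV_deriv_iff_real_differentiable)
qed

lemma test_function_higher_deriv:
  "test_function \<phi> \<Longrightarrow> test_function ((deriv ^^ m) \<phi>)"
  by (induction m) (auto intro: test_function_deriv)

lemma continuous_on_test_function:
  "test_function \<phi> \<Longrightarrow> continuous_on S \<phi>"
  by (meson DERIV_isCont continuous_at_imp_continuous_on test_function_DERIV)

lemma test_function_endpoints:
  "test_function \<phi> \<Longrightarrow> \<phi> 0 = 0" "test_function \<phi> \<Longrightarrow> \<phi> 1 = 0"
  unfolding test_function_def by force+

text \<open>
  Integration by parts \<open>m\<close> times: each step moves one derivative from the test function to the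
  polynomial, and the boundary terms vanish because test functions vanish near \<open>0\<close> and \<open>1\<close>.
\<close>

lemma integral_poly_mult_higher_deriv:
  assumes "test_function \<phi>"
  shows "integral {0..1} (\<lambda>x. poly p x * (deriv ^^ m) \<phi> x) =
    (-1) ^ m * integral {0..1} (\<lambda>x. poly ((pderiv ^^ m) p) x * \<phi> x)"
  using assms
proof (induction m arbitrary: \<phi>)
  case 0
  then show ?case by simp
next
  case (Suc m)
  let ?q = "(pderiv ^^ m) p"
  have cont: "continuous_on {0..1} \<phi>" "continuous_on {0..1} (deriv \<phi>)"
    using Suc.prems test_function_deriv continuous_on_test_function by blast+
  have int: "(\<lambda>x. poly ?q x * deriv \<phi> x) integrable_on {0..1}"
    "(\<lambda>x. poly (pderiv ?q) x * \<phi> x) integrable_on {0..1}"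
    by (intro integrable_continuous_interval continuous_intros cont)+
  have "((\<lambda>x. poly ?q x * \<phi> x) has_real_derivative
      (poly ?q x * deriv \<phi> x + poly (pderiv ?q) x * \<phi> x)) (at x within {0..1})" for x
    by (intro has_field_derivative_at_within[OF DERIV_mult'] poly_DERIV
        test_function_DERIV Suc.prems)
  then have "((\<lambda>x. poly ?q x * deriv \<phi> x + poly (pderiv ?q) x * \<phi> x) has_integral
      (poly ?q 1 * \<phi> 1 - poly ?q 0 * \<phi> 0)) {0..1}"
    by (intro fundamental_theorem_of_calculus)
       (simp_all flip: has_real_derivative_iff_has_vector_derivative)
  then have "integral {0..1} (\<lambda>x. poly ?q x * deriv \<phi> x + poly (pderiv ?q) x * \<phi> x) = 0"
    using test_function_endpoints[OF Suc.prems] by (simp add: integral_unique)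
  then have "integral {0..1} (\<lambda>x. poly ?q x * deriv \<phi> x) =
      - integral {0..1} (\<lambda>x. poly (pderiv ?q) x * \<phi> x)"
    using integral_add[OF int] by simp
  then show ?case
    using Suc.IH[OF test_function_deriv[OF Suc.prems]]
    by (simp add: funpow_swap1)
qed

lemma has_gen_deriv_poly: "has_gen_deriv m (poly p) (poly ((pderiv ^^ m) p))"
proof -
  have int: "set_integrable lebesgue {0..1} f" if "continuous_on {0..1} f" for f :: "real \<Rightarrow> real"
    using absolutely_integrable_continuous_real[OF that] .
  have "(LINT x:{0..1}|lebesgue. poly p x * (deriv ^^ m) \<phi> x) =
        (-1) ^ m * (LINT x:{0..1}|lebesgue. poly ((pderiv ^^ m) p) x * \<phi> x)"
    if "test_function \<phi>" for \<phi>
    by (subst (1 2) set_lebesgue_integral_eq_integral)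
       (intro int continuous_intros continuous_on_test_function
          test_function_higher_deriv that integral_poly_mult_higher_deriv)+
  then show ?thesis
    unfolding has_gen_deriv_def by (auto intro!: int continuous_intros)
qed

text \<open>
  Each differentiation lowers the multiplicity of a root by at most one.
\<close>

lemma poly_higher_pderiv_eq_0:
  fixes p :: "'a :: idom poly"
  assumes "[:- a, 1:] ^ m dvd p" and "i < m"
  shows "poly ((pderiv ^^ i) p) a = 0"
  using assms
proof (induction i arbitrary: p m)
  case 0
  then have "[:- a, 1:] dvd p"
    by (metis dvd_power dvd_trans)
  then show ?case
    by (simp add: poly_eq_0_iff_dvd)
next
  case (Suc i)
  then obtain m' where m: "m = Suc m'" "i < m'"
    by (metis Suc_less_eq2)
  obtain q where "p = [:- a, 1:] ^ Suc m' * q"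
    using Suc.prems m by (metis dvdE)
  moreover have "[:- a, 1:] ^ m' dvd [:- a, 1:] ^ Suc m'"
    by (rule le_imp_power_dvd) simp
  ultimately have "[:- a, 1:] ^ m' dvd pderiv p"
    by (simp only: lemma_order_pderiv1 dvd_add dvd_smult dvd_mult dvd_mult2 dvd_refl)
  then show ?case
    using Suc.IH m by (simp add: funpow_swap1)
qed

lemma higher_pderiv_degree:
  fixes p :: "'a :: {idom, semiring_char_0} poly"
  shows "(pderiv ^^ degree p) p = [:fact (degree p) * lead_coeff p:]"
proof -
  have "degree ((pderiv ^^ degree p) p) = 0"
    by (simp add: degree_higher_pderiv)
  moreover have "coeff ((pderiv ^^ degree p) p) 0 = fact (degree p) * lead_coeff p"
    by (simp add: coeff_higher_pderiv pochhammer_fact)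
  ultimately show ?thesis
    by (metis degree_0_id)
qed

text \<open>
  This is the polynomial with the boundary zeros prescribed by \<open>Z n k\<close> and with derivative of
  order \<open>n\<close> equal to \<open>1\<close>; the leading coefficient \<open>1 / fact n\<close> achieves the latter.
\<close>

definition unit_deriv_poly :: "nat \<Rightarrow> nat \<Rightarrow> real poly" where
  "unit_deriv_poly n k = smult (1 / fact n) ([:0, 1:] ^ k * [:- 1, 1:] ^ (n - k))"

lemma higher_pderiv_unit_deriv_poly:
  assumes "k \<le> n"
  shows "(pderiv ^^ n) (unit_deriv_poly n k) = 1"
proof -
  let ?p = "[:0, 1:] ^ k * [:- 1, 1:] ^ (n - k) :: real poly"
  have "degree ?p = n"
    using assms by (simp add: degree_mult_eq degree_power_eq)
  moreover have "lead_coeff ?p = 1"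
    unfolding lead_coeff_mult lead_coeff_power by simp
  ultimately have "(pderiv ^^ n) ?p = [:fact n:]"
    using higher_pderiv_degree[of ?p] by simp
  then show ?thesis
    by (simp add: unit_deriv_poly_def higher_pderiv_smult)
qed

lemma unit_deriv_poly_in_Z: "poly (unit_deriv_poly n k) \<in> Z n k"
proof -
  let ?p = "unit_deriv_poly n k"
  have val: "gen_deriv_value i (poly ?p) x 0" if "poly ((pderiv ^^ i) ?p) x = 0" for i x
    unfolding gen_deriv_value_def using that has_gen_deriv_poly
    by (intro exI[of _ "poly ((pderiv ^^ i) ?p)"]) (auto intro!: continuous_intros)
  have "[:- 0, 1:] ^ k dvd ?p" "[:- 1, 1:] ^ (n - k) dvd ?p"
    by (simp_all add: unit_deriv_poly_def dvd_smult)
  note roots = this[THEN poly_higher_pderiv_eq_0]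
  show ?thesis
    unfolding Z_def using has_gen_deriv_poly roots
    by (auto intro!: val continuous_intros)
qed

lemma abs_poly_unit_deriv_poly:
  assumes "x \<in> {0..1}"
  shows "\<bar>poly (unit_deriv_poly n k) x\<bar> = x ^ k * (1 - x) ^ (n - k) / fact n"
  using assms by (simp add: unit_deriv_poly_def abs_mult power_abs)

section \<open>Integral inequalities on the unit interval\<close>

lemma has_integral_power_mult_power:
  "((\<lambda>x::real. x ^ a * (1 - x) ^ b) has_integral (fact a * fact b / fact (a + b + 1))) {0..1}"
proof -
  have "((\<lambda>x. x powr (real (Suc a) - 1) * (1 - x) powr (real (Suc b) - 1)) has_integral
      Beta (real (Suc a)) (real (Suc b))) {0..1}"
    by (rule has_integral_Beta_real) auto
  moreover have "Beta (real (Suc a)) (real (Suc b)) = fact a * fact b / fact (a + b + 1)"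
    using Gamma_fact[of a, where 'a = real] Gamma_fact[of b, where 'a = real]
      Gamma_fact[of "a + b + 1", where 'a = real]
    by (simp add: Beta_def add_ac)
  ultimately have "((\<lambda>x. x powr real a * (1 - x) powr real b) has_integral
      (fact a * fact b / fact (a + b + 1))) {0..1}"
    by simp
  then show ?thesis
    by (rule has_integral_spike_finite[of "{0, 1}", rotated 2]) (auto simp: powr_realpow)
qed

lemma powr_ge_tangent:
  fixes c y p :: real
  assumes "0 < c" "0 \<le> y" "1 \<le> p"
  shows "c powr p + p * c powr (p - 1) * (y - c) \<le> y powr p"
proof (cases "y = 0")
  \<comment> \<open>Convexity gives the tangent inequality on the open half-line, so \<open>0\<close> is treated apart.\<close>
  case True
  have "c powr p = c * c powr (p - 1)"
    using powr_add[of c 1 "p - 1"] assms by simp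
  moreover have "(1 - p) * (c * c powr (p - 1)) \<le> 0"
    using assms by (intro mult_nonpos_nonneg) auto
  ultimately show ?thesis
    using True by (simp add: algebra_simps)
next
  case False
  have "p * c powr (p - 1) * (y - c) \<le> y powr p - c powr p"
    by (rule convex_on_imp_above_tangent[OF powr_convex[OF assms(3)]])
       (use assms False in \<open>auto intro!: derivative_eq_intros simp: interior_open\<close>)
  then show ?thesis by simp
qed

text \<open>
  Jensen's inequality for \<open>y powr p\<close> on the probability space \<open>[0,1]\<close>: the tangent line at the
  mean \<open>c\<close> lies below the graph, and its linear term integrates to \<open>0\<close>.
\<close>

lemma powr_integral_le_integral_powr:
  fixes f :: "real \<Rightarrow> real"
  assumes cont: "continuous_on {0..1} f" and nonneg: "\<And>x. x \<in> {0..1} \<Longrightarrow> 0 \<le> f x"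
    and c: "(f has_integral c) {0..1}" "0 < c" and p: "1 \<le> p"
  shows "c powr p \<le> integral {0..1} (\<lambda>x. f x powr p)"
proof (rule has_integral_le)
  have "((\<lambda>x. c powr p + p * c powr (p - 1) * (f x - c)) has_integral
      (c powr p + p * c powr (p - 1) * (c - c))) {0..1}"
    using has_integral_const_real[of "c powr p" 0 1] has_integral_const_real[of c 0 1]
    by (intro has_integral_add has_integral_mult_right has_integral_diff c) auto
  then show "((\<lambda>x. c powr p + p * c powr (p - 1) * (f x - c)) has_integral c powr p) {0..1}"
    by simp
  show "((\<lambda>x. f x powr p) has_integral integral {0..1} (\<lambda>x. f x powr p)) {0..1}"
    using p by (intro integrable_integral integrable_continuous_interval continuous_on_powr' 
      continuous_intros cont) (auto simp: nonneg)
qed (use powr_ge_tangent c p nonneg in auto)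

section \<open>Grand Lebesgue norms of dilations\<close>

lemma Lp_norm_dilation:
  assumes cont: "continuous_on {0..1} f" and \<Delta>: "0 < \<Delta>" and p: "0 < p"
  shows "Lp_norm p (dilation \<Delta> (zero_extension f)) =
    ennreal ((\<Delta> * integral {0..1} (\<lambda>x. \<bar>f x\<bar> powr p)) powr (1 / p))"
proof -
  let ?J = "integral {0..1} (\<lambda>x. \<bar>f x\<bar> powr p)"
  have int: "((\<lambda>x. \<bar>f x\<bar> powr p) has_integral ?J) {0..1}"
    using p by (intro integrable_integral integrable_continuous_interval continuous_on_powr'
      continuous_intros cont) auto
  have J: "0 \<le> ?J"
    by (rule has_integral_nonneg[OF int]) simp
  have "(\<lambda>x. indicator {0..1} x *\<^sub>R f x) \<in> borel_measurable borel"
    by (rule borel_measurable_continuous_on_indicator[OF _ cont]) simp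
  also have "(\<lambda>x. indicator {0..1} x *\<^sub>R f x) = zero_extension f"
    by (auto simp: zero_extension_def indicator_def)
  finally have [measurable]: "zero_extension f \<in> borel_measurable borel" .
  have "(\<integral>\<^sup>+ x. ennreal (\<bar>dilation \<Delta> (zero_extension f) x\<bar> powr p) \<partial>lebesgue) =
      (\<integral>\<^sup>+ x. ennreal (\<bar>zero_extension f (x / \<Delta>)\<bar> powr p) \<partial>lborel)"
    by (simp add: nn_integral_completion dilation_def)
  also have "\<dots> = ennreal \<Delta> * (\<integral>\<^sup>+ x. ennreal (\<bar>zero_extension f x\<bar> powr p) \<partial>lborel)"
    using \<Delta> by (subst nn_integral_real_affine[where c = \<Delta> and t = 0]) auto
  also have "(\<integral>\<^sup>+ x. ennreal (\<bar>zero_extension f x\<bar> powr p) \<partial>lborel) =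
      (\<integral>\<^sup>+ x. ennreal (\<bar>f x\<bar> powr p) * indicator {0..1} x \<partial>lborel)"
    by (intro nn_integral_cong) (auto simp: zero_extension_def indicator_def)
  also have "\<dots> = ennreal ?J"
    by (rule nn_integral_has_integral_lebesgue'[OF _ int]) simp
  also have "ennreal \<Delta> * ennreal ?J = ennreal (\<Delta> * ?J)"
    using \<Delta> J by (simp add: ennreal_mult)
  finally show ?thesis
    using \<Delta> J by (simp add: Lp_norm_def)
qed

lemma exponents_gt_1:
  assumes "gls_weight A B \<psi>" "p \<in> exponents A B"
  shows "1 < p" "0 < \<psi> p"
  using assms by (auto simp: gls_weight_def exponents_def)

lemma exponents_nonempty:
  assumes "gls_weight A B \<psi>"
  shows "exponents A B \<noteq> {}"
proof -
  obtain p where "ereal A < ereal p" "ereal p < B"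
    using assms ereal_dense2[of "ereal A" B] unfolding gls_weight_def by blast
  then show ?thesis
    by (auto simp: exponents_def)
qed

lemma gls_fundamental_pos:
  assumes "gls_weight A B \<psi>" "0 < \<Delta>"
  shows "0 < gls_fundamental A B \<psi> \<Delta>"
proof -
  obtain p where p: "p \<in> exponents A B"
    using exponents_nonempty[OF assms(1)] by blast
  have "0 < ennreal (\<Delta> powr (1 / p) / \<psi> p)"
    using assms exponents_gt_1[OF _ p] by simp
  also have "\<dots> \<le> gls_fundamental A B \<psi> \<Delta>"
    unfolding gls_fundamental_def using p by (rule SUP_upper)
  finally show ?thesis .
qed

text \<open>
  The weight is bounded away from \<open>0\<close>, and \<open>\<Delta> powr (1 / p)\<close> is at most \<open>max 1 \<Delta>\<close> because
  all exponents exceed \<open>1\<close>.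
\<close>

lemma gls_fundamental_finite:
  assumes w: "gls_weight A B \<psi>" and \<Delta>: "0 < \<Delta>"
  shows "gls_fundamental A B \<psi> \<Delta> < \<infinity>"
proof -
  obtain r where r: "0 < r" "ereal r < (INF p\<in>exponents A B. ereal (\<psi> p))"
    using w ereal_dense2[of 0 "INF p\<in>exponents A B. ereal (\<psi> p)"]
    by (auto simp: gls_weight_def)
  have "\<Delta> powr (1 / p) / \<psi> p \<le> max 1 \<Delta> / r" if p: "p \<in> exponents A B" for p
  proof (rule frac_le)
    have "1 < p" by (rule exponents_gt_1[OF w p])
    have "\<Delta> powr (1 / p) \<le> max 1 \<Delta> powr (1 / p)"
      using \<Delta> \<open>1 < p\<close> by (intro powr_mono2) auto
    also have "\<dots> \<le> max 1 \<Delta> powr 1"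
      using \<open>1 < p\<close> by (intro powr_mono) auto
    finally show "\<Delta> powr (1 / p) \<le> max 1 \<Delta>" by simp
    have "ereal r < ereal (\<psi> p)"
      using r(2) p by (meson INF_lower less_le_trans)
    then show "r \<le> \<psi> p" by simp
  qed (use r in auto)
  then have "gls_fundamental A B \<psi> \<Delta> \<le> ennreal (max 1 \<Delta> / r)"
    unfolding gls_fundamental_def by (intro SUP_least ennreal_leI)
  then show ?thesis
    using le_less_trans ennreal_less_top by fastforce
qed

lemma gls_norm_dilation_1:
  assumes w: "gls_weight A B \<psi>" and \<Delta>: "0 < \<Delta>"
  shows "gls_norm A B \<psi> (dilation \<Delta> (zero_extension (\<lambda>_. 1))) = gls_fundamental A B \<psi> \<Delta>"
  unfolding gls_norm_def gls_fundamental_def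
proof (rule SUP_cong[OF refl])
  fix p assume p: "p \<in> exponents A B"
  show "Lp_norm p (dilation \<Delta> (zero_extension (\<lambda>_. 1))) / ennreal (\<psi> p) =
      ennreal (\<Delta> powr (1 / p) / \<psi> p)"
    using \<Delta> exponents_gt_1[OF w p]
    by (subst Lp_norm_dilation) (auto simp: divide_ennreal)
qed

text \<open>
  Jensen's inequality bounds the \<open>L\<^sup>p\<close> norm of the dilation from below by \<open>c * \<Delta> powr (1 / p)\<close>
  for every exponent. As \<open>c\<close> does not depend on \<open>p\<close>, it can be taken out of the supremum over
  \<open>p\<close>, and what remains is the fundamental function.
\<close>

lemma gls_norm_dilation_ge:
  assumes w: "gls_weight A B \<psi>" and \<Delta>: "0 < \<Delta>" and cont: "continuous_on {0..1} f"
    and c: "((\<lambda>x. \<bar>f x\<bar>) has_integral c) {0..1}" "0 < c"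
  shows "ennreal c * gls_fundamental A B \<psi> \<Delta> \<le>
    gls_norm A B \<psi> (dilation \<Delta> (zero_extension f))"
  unfolding gls_norm_def gls_fundamental_def SUP_mult_left_ennreal
proof (rule SUP_subset_mono[OF order_refl])
  fix p assume p: "p \<in> exponents A B"
  note p' = exponents_gt_1[OF w p]
  have "c powr p \<le> integral {0..1} (\<lambda>x. \<bar>f x\<bar> powr p)"
    using p' by (intro powr_integral_le_integral_powr[OF _ _ c] continuous_intros cont) auto
  then have "(\<Delta> * c powr p) powr (1 / p) \<le> 
      (\<Delta> * integral {0..1} (\<lambda>x. \<bar>f x\<bar> powr p)) powr (1 / p)"
    using \<Delta> p' by (intro powr_mono2 mult_left_mono) auto
  moreover have "(\<Delta> * c powr p) powr (1 / p) = c * \<Delta> powr (1 / p)"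
    using \<Delta> c(2) p' by (simp add: powr_mult powr_powr)
  ultimately have "c * \<Delta> powr (1 / p) / \<psi> p \<le>
      (\<Delta> * integral {0..1} (\<lambda>x. \<bar>f x\<bar> powr p)) powr (1 / p) / \<psi> p"
    using p' by (simp add: divide_right_mono)
  then show "ennreal c * ennreal (\<Delta> powr (1 / p) / \<psi> p) \<le>
      Lp_norm p (dilation \<Delta> (zero_extension f)) / ennreal (\<psi> p)"
    using \<Delta> c(2) p' 
    by (subst Lp_norm_dilation[OF cont])
       (auto simp: divide_ennreal ennreal_leI simp flip: ennreal_mult)
qed

section \<open>The lower bound\<close>

text \<open>
  In the binomial expansion of \<open>(k + (n - k)) ^ n = n ^ n\<close> the term with index \<open>k\<close> is
  \<open>(n choose k) * k ^ k * (n - k) ^ (n - k)\<close>, and it is at most the whole sum; replacing \<open>n ^ n\<close> by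
  \<open>(n + 1) ^ n\<close> loses a little more.
\<close>

lemma power_mult_power_le_fact:
  assumes "k \<le> n"
  shows "real k ^ k * real (n - k) ^ (n - k) / real (n + 1) ^ (n + 1) \<le>
    fact k * fact (n - k) / fact (n + 1)"
proof -
  have "real (n choose k) * real k ^ k * real (n - k) ^ (n - k) \<le>
      (\<Sum>j\<le>n. real (n choose j) * real k ^ j * real (n - k) ^ (n - j))"
    using assms
    by (intro member_le_sum[of k _ "\<lambda>j. real (n choose j) * real k ^ j * real (n - k) ^ (n - j)"])
       auto
  also have "\<dots> = real n ^ n"
    using binomial_ring[of "real k" "real (n - k)" n] assms by simp
  also have "\<dots> \<le> real (n + 1) ^ n"
    by (intro power_mono) auto
  finally have "fact n / (fact k * fact (n - k)) * (real k ^ k * real (n - k) ^ (n - k)) \<le>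
      real (n + 1) ^ n"
    using binomial_fact[OF assms, where 'a = real] by (simp add: mult.assoc)
  then have "fact n * (real k ^ k * real (n - k) ^ (n - k)) \<le>
      real (n + 1) ^ n * (fact k * fact (n - k))"
    by (simp add: field_simps)
  then have "real (n + 1) * (fact n * (real k ^ k * real (n - k) ^ (n - k))) \<le>
      real (n + 1) * (real (n + 1) ^ n * (fact k * fact (n - k)))"
    by (rule mult_left_mono) simp
  then have "real k ^ k * real (n - k) ^ (n - k) * fact (n + 1) \<le>
      fact k * fact (n - k) * real (n + 1) ^ (n + 1)"
    by (simp add: algebra_simps)
  then show ?thesis
    by (simp add: divide_simps del: fact_Suc power_Suc of_nat_Suc of_nat_add)
qed

theorem theorem4p1:
  fixes n k :: nat and A C :: real and B D :: ereal and \<psi> \<nu> :: "real \<Rightarrow> real"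
  assumes "2 \<le> n" and "k < n"
    and "gls_weight A B \<psi>" and "gls_weight C D \<nu>"
  shows "V0 n k A B \<psi> C D \<nu> \<ge>
    ennreal ((real k ^ k * real (n - k) ^ (n - k)) / (fact n * real (n + 1) ^ (n + 1)))"
proof -
  define g where "g = poly (unit_deriv_poly n k)"
  define c :: real where "c = fact k * fact (n - k) / fact (n + 1) / fact n"
  have "((\<lambda>x. x ^ k * (1 - x) ^ (n - k) / fact n) has_integral c) {0..1}"
    unfolding c_def using has_integral_power_mult_power[of k "n - k"] \<open>k < n\<close>
    by (intro has_integral_divide) simp
  then have c: "((\<lambda>x. \<bar>g x\<bar>) has_integral c) {0..1}"
    by (rule has_integral_eq[rotated]) (simp add: g_def abs_poly_unit_deriv_poly)
  have "0 < c"
    by (simp add: c_def)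
  have "(\<lambda>_. 1) = poly ((pderiv ^^ n) (unit_deriv_poly n k))"
    using higher_pderiv_unit_deriv_poly[of k n] \<open>k < n\<close> by auto
  then have deriv: "has_gen_deriv n g (\<lambda>_. 1)"
    unfolding g_def using has_gen_deriv_poly by metis
  have nonzero: "\<not> (AE x::real in lebesgue. x \<in> {0..1} \<longrightarrow> (1::real) = 0)"
  proof
    assume "AE x::real in lebesgue. x \<in> {0..1} \<longrightarrow> (1::real) = 0"
    then have "AE x::real in lebesgue. x \<notin> {0..1}"
      by simp
    then have "emeasure lebesgue {0..1::real} = 0"
      by (subst (asm) AE_iff_null_sets[symmetric]) auto
    then show False by simp
  qed
  have "(real k ^ k * real (n - k) ^ (n - k)) / (fact n * real (n + 1) ^ (n + 1)) \<le> c"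
    using divide_right_mono[OF power_mult_power_le_fact[of k n], of "fact n"] \<open>k < n\<close>
    by (simp add: c_def mult.commute)
  also have "ennreal c \<le> V0 n k A B \<psi> C D \<nu>"
    unfolding V0_def
  proof (rule INF_greatest, rule SUP_upper2)
    fix \<Delta> :: real
    assume "\<Delta> \<in> {0<..}"
    then have \<Delta>: "0 < \<Delta>" by simp
    show "(g, \<lambda>_. 1) \<in> {(g, h). g \<in> Z n k \<and> has_gen_deriv n g h \<and>
        \<not> (AE x in lebesgue. x \<in> {0..1} \<longrightarrow> h x = 0)}"
      using deriv nonzero unit_deriv_poly_in_Z by (simp add: g_def)
    let ?N = "gls_norm C D \<nu> (dilation \<Delta> (zero_extension g))"
    let ?\<phi> = "gls_fundamental C D \<nu> \<Delta>"
    have \<phi>: "0 < ?\<phi>" "?\<phi> < \<infinity>" 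
      using gls_fundamental_pos gls_fundamental_finite assms \<Delta> by blast+
    have "ennreal c = ennreal c * ?\<phi> / ?\<phi>"
      using \<phi> by (simp add: mult_divide_eq_ennreal)
    also have "\<dots> \<le> ?N / ?\<phi>"
      by (intro divide_right_mono_ennreal gls_norm_dilation_ge assms \<Delta> c \<open>0 < c\<close>)
         (simp add: g_def continuous_intros)
    also have "\<dots> = ?N / ?\<phi> / (gls_norm A B \<psi> (dilation \<Delta> (zero_extension (\<lambda>_. 1))) /
        gls_fundamental A B \<psi> \<Delta>)"
      using gls_fundamental_pos[OF assms(3) \<Delta>] gls_fundamental_finite[OF assms(3) \<Delta>]
        mult_divide_eq_ennreal[of 1 "?N / ?\<phi>"]
      by (simp add: gls_norm_dilation_1[OF assms(3) \<Delta>])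
    finally show "ennreal c \<le> (case (g, \<lambda>_. 1) of (g, h) \<Rightarrow>
        gls_norm C D \<nu> (dilation \<Delta> (zero_extension g)) / gls_fundamental C D \<nu> \<Delta> /
        (gls_norm A B \<psi> (dilation \<Delta> (zero_extension h)) / gls_fundamental A B \<psi> \<Delta>))"
      by simp
  qed
  finally show ?thesis
    by (simp add: ennreal_leI)
qed

end
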